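(* Let $(Z_t,X_t)_{t\ge 1}$ be the univariate discrete-time marked Hawkes process with base intensity $\nu>0$, exciting function $\alpha$ and i.i.d. positive marks $\ell_{t,j}$ of finite mean, with $\Vert\alpha\Vert_1\mathbb{E}[\ell_{1,1}]<1$ (as defined in the context), and let $L_t=\sum_{s=1}^{t}X_s$. Then $$\frac{L_t}{t}\longrightarrow\frac{\nu\,\mathbb{E}[\ell_{1,1}]}{1-\Vert\alpha\Vert_1\mathbb{E}[\ell_{1,1}]}$$ in probability as $t\to\infty$.
   Context: Univariate discrete-time marked Hawkes process. Let $\nu>0$, let $\alpha:\mathbb{N}\cup\{0\}\to\mathbb{R}_+$ be a positive function, and put $\Vert\alpha\Vert_1:=\sum_{t=1}^{\infty}\alpha(t)$. Let $(\ell_{t,j})_{t\ge1,\,j\ge1}$ be positive random variables, i.i.d. in both $t$ and $j$, with finite mean. Set $X_0=N_0=0$. For $t\ge1$ let $$\lambda_t:=\nu+\sum_{s=1}^{t-1}\alpha(s)X_{t-s}$$ (so $\lambda_1=\nu$). Let $\mathcal{F}_t=\sigma(Z_s,X_s:1\le s\le t)$ be the natural filtration, with $\mathcal{F}_0$ trivial. Conditionally on $\mathcal{F}_{t-1}$, $Z_t$ is a Poisson random variable with mean $\lambda_t$, and $$X_t:=\sum_{j=1}^{Z_t}\ell_{t,j},$$ where the marks $(\ell_{t,j})_{j\ge1}$ at time $t$ are independent of $\sigma(\mathcal{F}_{t-1},Z_t)$. Standing assumption: $\Vert\alpha\Vert_1\mathbb{E}[\ell_{1,1}]<1$. Define $N_t:=\sum_{s=1}^tZ_s$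 and $L_t:=\sum_{s=1}^tX_s$. *)

theory Defs
  imports "HOL-Probability.Probability"
begin

text \<open>Time is indexed by \<^typ>\<open>nat\<close>; the process and the marks are only meaningful for indices
  \<open>t, j \<ge> 1\<close>, and nothing is assumed about \<open>Z 0\<close>, \<open>ell 0 j\<close> or \<open>ell t 0\<close>.\<close>

definition hawkes_X :: "(nat \<Rightarrow> nat \<Rightarrow> 'a \<Rightarrow> real) \<Rightarrow> (nat \<Rightarrow> 'a \<Rightarrow> nat) \<Rightarrow> nat \<Rightarrow> 'a \<Rightarrow> real" where
  "hawkes_X ell Z t \<omega> = (if t = 0 then 0 else \<Sum>j=1..Z t \<omega>. ell t j \<omega>)"

definition hawkes_L :: "(nat \<Rightarrow> nat \<Rightarrow> 'a \<Rightarrow> real) \<Rightarrow> (nat \<Rightarrow> 'a \<Rightarrow> nat) \<Rightarrow> nat \<Rightarrow> 'a \<Rightarrow> real" where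
  "hawkes_L ell Z t \<omega> = (\<Sum>s=1..t. hawkes_X ell Z s \<omega>)"

definition hawkes_intensity ::
    "real \<Rightarrow> (nat \<Rightarrow> real) \<Rightarrow> (nat \<Rightarrow> nat \<Rightarrow> 'a \<Rightarrow> real) \<Rightarrow> (nat \<Rightarrow> 'a \<Rightarrow> nat) \<Rightarrow> nat \<Rightarrow> 'a \<Rightarrow> real" where
  "hawkes_intensity \<nu> \<alpha> ell Z t \<omega> = \<nu> + (\<Sum>s=1..t-1. \<alpha> s * hawkes_X ell Z (t - s) \<omega>)"

definition hawkes_filtration ::
    "'a measure \<Rightarrow> (nat \<Rightarrow> nat \<Rightarrow> 'a \<Rightarrow> real) \<Rightarrow> (nat \<Rightarrow> 'a \<Rightarrow> nat) \<Rightarrow> nat \<Rightarrow> 'a measure" where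
  "hawkes_filtration M ell Z t = sigma (space M)
     (\<Union>s\<in>{1..t}. sets (vimage_algebra (space M) (Z s) (count_space UNIV)) \<union>
                  sets (vimage_algebra (space M) (hawkes_X ell Z s) borel))"

text \<open>\<open>\<sigma>(\<F>\<^sub>t\<^sub>-\<^sub>1, Z\<^sub>t)\<close>\<close>
definition hawkes_past ::
    "'a measure \<Rightarrow> (nat \<Rightarrow> nat \<Rightarrow> 'a \<Rightarrow> real) \<Rightarrow> (nat \<Rightarrow> 'a \<Rightarrow> nat) \<Rightarrow> nat \<Rightarrow> 'a measure" where
  "hawkes_past M ell Z t = sigma (space M)
     (sets (hawkes_filtration M ell Z (t - 1)) \<union>
      sets (vimage_algebra (space M) (Z t) (count_space UNIV)))"

definition mark_algebra ::
    "'a measure \<Rightarrow> (nat \<Rightarrow> nat \<Rightarrow> 'a \<Rightarrow> real) \<Rightarrow> nat \<Rightarrow> 'a measure" where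
  "mark_algebra M ell t = sigma (space M)
     (\<Union>j\<in>{1..}. sets (vimage_algebra (space M) (ell t j) borel))"

definition norm1 :: "(nat \<Rightarrow> real) \<Rightarrow> real" where
  "norm1 \<alpha> = (\<Sum>t. \<alpha> (Suc t))"

text \<open>In \<open>Z_cond\<close> the rate is at least \<open>\<nu> > 0\<close> almost surely, which is where
  \<^const>\<open>poisson_pmf\<close> is the Poisson law.\<close>
locale marked_hawkes = prob_space M
  for M :: "'a measure"
    and \<nu> :: real
    and \<alpha> :: "nat \<Rightarrow> real"
    and ell :: "nat \<Rightarrow> nat \<Rightarrow> 'a \<Rightarrow> real"
    and Z :: "nat \<Rightarrow> 'a \<Rightarrow> nat" +
  assumes nu_pos: "\<nu> > 0"
    and alpha_nonneg: "\<And>t. \<alpha> t \<ge> 0"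
    and marks_indep: "indep_vars (\<lambda>_. borel) (\<lambda>(t, j). ell t j) ({1..} \<times> {1..})"
    and marks_ident: "\<And>t j. t \<ge> 1 \<Longrightarrow> j \<ge> 1 \<Longrightarrow> distr M borel (ell t j) = distr M borel (ell 1 1)"
    and marks_pos: "\<And>t j. t \<ge> 1 \<Longrightarrow> j \<ge> 1 \<Longrightarrow> AE \<omega> in M. ell t j \<omega> > 0"
    and marks_integrable: "integrable M (ell 1 1)"
    and Z_measurable: "\<And>t. t \<ge> 1 \<Longrightarrow> Z t \<in> measurable M (count_space UNIV)"
    and Z_cond: "\<And>t k. t \<ge> 1 \<Longrightarrow>
      AE \<omega> in M. real_cond_exp M (hawkes_filtration M ell Z (t - 1))
          (indicat_real {\<omega> \<in> space M. Z t \<omega> = k}) \<omega>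
        = pmf (poisson_pmf (hawkes_intensity \<nu> \<alpha> ell Z t \<omega>)) k"
    and marks_indep_past: "\<And>t. t \<ge> 1 \<Longrightarrow>
      indep_set (sets (mark_algebra M ell t)) (sets (hawkes_past M ell Z t))"

definition tendsto_in_prob :: "'a measure \<Rightarrow> (nat \<Rightarrow> 'a \<Rightarrow> real) \<Rightarrow> real \<Rightarrow> bool" where
  "tendsto_in_prob M Y c \<longleftrightarrow>
     (\<forall>\<epsilon>>0. (\<lambda>t. measure M {\<omega> \<in> space M. \<bar>Y t \<omega> - c\<bar> > \<epsilon>}) \<longlonglongrightarrow> 0)"

text \<open>\<^const>\<open>real_cond_exp\<close> is the conditional expectation only relative to a genuine
  sub-\<open>\<sigma>\<close>-algebra (it is \<open>0\<close> otherwise), and \<^const>\<open>measure\<close> is \<open>0\<close> on non-measurable sets;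
  the lemmas below exclude both degeneracies.\<close>
context marked_hawkes
begin

lemma mark_measurable:
  assumes "t \<ge> 1" "j \<ge> 1"
  shows "ell t j \<in> borel_measurable M"
proof -
  have "random_variable borel ((\<lambda>(t, j). ell t j) (t, j))"
    using marks_indep assms unfolding indep_vars_def by blast
  then show ?thesis by simp
qed

lemma hawkes_X_measurable: "hawkes_X ell Z t \<in> borel_measurable M"
proof (cases "t = 0")
  case True
  then show ?thesis by (simp add: hawkes_X_def[abs_def])
next
  case False
  then have t: "t \<ge> 1" by simp
  have "(\<lambda>\<omega>. \<Sum>j=1..Z t \<omega>. ell t j \<omega>) \<in> borel_measurable M"
    by (rule measurable_compose_countable[OF _ Z_measurable[OF t]])
      (auto intro!: borel_measurable_sum mark_measurable t)
  then show ?thesis using False by (simp add: hawkes_X_def[abs_def])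
qed

lemma hawkes_L_measurable: "hawkes_L ell Z t \<in> borel_measurable M"
  unfolding hawkes_L_def[abs_def] by (intro borel_measurable_sum hawkes_X_measurable)

lemma hawkes_filtration_subalgebra: "subalgebra M (hawkes_filtration M ell Z t)"
proof -
  let ?G = "\<Union>s\<in>{1..t}. sets (vimage_algebra (space M) (Z s) (count_space UNIV)) \<union>
                  sets (vimage_algebra (space M) (hawkes_X ell Z s) borel)"
  have sub: "?G \<subseteq> sets M"
  proof (safe)
    fix s A assume "s \<in> {1..t}" "A \<in> sets (vimage_algebra (space M) (Z s) (count_space UNIV))"
    then show "A \<in> sets M"
      using measurable_sets[OF Z_measurable[of s]] by (auto simp: sets_vimage_algebra2)
  next
    fix s A assume "A \<in> sets (vimage_algebra (space M) (hawkes_X ell Z s) borel)"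
    then show "A \<in> sets M"
      using measurable_sets[OF hawkes_X_measurable[of s]] by (auto simp: sets_vimage_algebra2)
  qed
  then have "?G \<subseteq> Pow (space M)" using sets.space_closed by blast
  then show ?thesis
    unfolding subalgebra_def hawkes_filtration_def
    using sub by (simp add: sets.sigma_sets_subset)
qed

end

end

theory Submission
  imports Defs "HOL-Real_Asymp.Real_Asymp"
begin

text \<open>Write \<open>m\<close> for the mean mark and \<open>p(x) = 1 - E[exp(-x ell)]\<close>. Conditionally on the past, \<open>X\<^sub>t\<close> is
  compound Poisson, so \<open>E[exp(-x X\<^sub>t) | F\<^sub>t\<^sub>-\<^sub>1] = exp(-p(x) \<lambda>\<^sub>t)\<close>. As \<open>\<lambda>\<^sub>t\<close> is affine in the
  earlier \<open>X\<^sub>s\<close>, integrating out \<open>X\<^sub>t, X\<^sub>t\<^sub>-\<^sub>1, \<dots>\<close> one at a time gives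
  \<open>E[exp(-x L\<^sub>t)] = exp(-\<nu> \<Sum>\<^sub>k\<^sub><\<^sub>t p(h(k)))\<close>, where \<open>h\<close> solves
  \<open>h(j) = x + \<Sum>\<^sub>k\<^sub><\<^sub>j p(h(k)) \<alpha>(j - k)\<close>. For \<open>x = \<theta>/t\<close> the weights \<open>h\<close> are
  uniformly \<open>O(1/t)\<close>, so \<open>p\<close> may be linearised as \<open>p(u) \<approx> m u\<close>; summing the recursion over \<open>j\<close> then
  shows that the exponent converges to \<open>-\<nu> m \<theta> / (1 - m norm1 \<alpha>)\<close>. Thus the Laplace transform of
  \<open>L\<^sub>t/t\<close> converges to that of a constant \<open>c\<close>. Only bounded random variables occur, so a
  first moment of the marks suffices.\<close>

subsection \<open>The weight recursion\<close>

text \<open>A discrete renewal-type equation in which \<open>j\<close> counts time backwards from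
  the horizon \<open>t\<close>: \<open>hawkes_weight p \<alpha> x j\<close> will be the coefficient
  of X_(t-j) in the exponent once the later X's have been integrated out. It does not depend on
  \<open>t\<close>.\<close>

fun hawkes_weight :: "(real \<Rightarrow> real) \<Rightarrow> (nat \<Rightarrow> real) \<Rightarrow> real \<Rightarrow> nat \<Rightarrow> real" where
  "hawkes_weight p \<alpha> x j = x + (\<Sum>k<j. p (hawkes_weight p \<alpha> x k) * \<alpha> (j - k))"

declare hawkes_weight.simps [simp del]

text \<open>Beyond \<open>N\<close> every term is below \<open>e / 2\<close>; the head is a constant
  \<open>C\<close>, which is less than \<open>n * (e / 2)\<close> once \<open>n\<close> exceeds
  \<open>2 * C / e\<close>.\<close>

lemma cesaro_null:
  fixes f :: "nat \<Rightarrow> real"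
  assumes "f \<longlonglongrightarrow> 0"
  shows "(\<lambda>n. (\<Sum>k<n. f k) / n) \<longlonglongrightarrow> 0"
proof (rule LIMSEQ_I)
  fix e :: real assume e: "e > 0"
  obtain N where N: "\<And>k. k \<ge> N \<Longrightarrow> \<bar>f k\<bar> < e / 2"
    using LIMSEQ_D[OF assms, of "e/2"] e by auto
  define C where "C = (\<Sum>k<N. \<bar>f k\<bar>)"
  have C: "C \<ge> 0" unfolding C_def by (intro sum_nonneg) auto
  obtain n0 :: nat where n0: "n0 > 2 * C / e" using reals_Archimedean2 by blast
  show "\<exists>no. \<forall>n\<ge>no. norm ((\<Sum>k<n. f k) / real n - 0) < e"
  proof (intro exI allI impI)
    fix n assume n: "n \<ge> max (max 1 N) n0"
    have "{..<n} = {..<N} \<union> {N..<n}" using n by auto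
    then have "(\<Sum>k<n. \<bar>f k\<bar>) = C + (\<Sum>k=N..<n. \<bar>f k\<bar>)"
      unfolding C_def by (simp add: sum.union_disjoint ivl_disj_int)
    also have "(\<Sum>k=N..<n. \<bar>f k\<bar>) \<le> real (card {N..<n}) * (e/2)"
      by (rule sum_bounded_above) (use N in force)
    also have "\<dots> \<le> n * (e/2)" using e by (intro mult_right_mono) auto
    finally have 1: "(\<Sum>k<n. \<bar>f k\<bar>) \<le> C + n * (e/2)" by simp
    have "real n0 \<le> n" using n by simp
    then have "2 * C / e < n" using n0 by linarith
    then have "C < n * (e/2)" using e by (simp add: field_simps)
    then have "(\<Sum>k<n. \<bar>f k\<bar>) < n * e" using 1 by simp
    moreover have "\<bar>\<Sum>k<n. f k\<bar> \<le> (\<Sum>k<n. \<bar>f k\<bar>)" by (rule sum_abs)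
    ultimately have "\<bar>\<Sum>k<n. f k\<bar> < n * e" by linarith
    then show "norm ((\<Sum>k<n. f k) / real n - 0) < e"
      using n by (simp add: field_simps)
  qed
qed

text \<open>Exchanging the two sums collects, for each \<open>k\<close>, the values of
  \<open>\<alpha>\<close> at lags 1 to \<open>n - 1 - k\<close>. The convolution thereby becomes a
  linear relation involving truncations of \<open>norm1 \<alpha>\<close>.\<close>

lemma sum_hawkes_weight:
  "(\<Sum>j<n. hawkes_weight p \<alpha> x j)
    = n * x + (\<Sum>k<n. p (hawkes_weight p \<alpha> x k) * (\<Sum>i<n - 1 - k. \<alpha> (Suc i)))"
proof -
  let ?q = "\<lambda>k. p (hawkes_weight p \<alpha> x k)"
  have "(\<Sum>j<n. hawkes_weight p \<alpha> x j) = n * x + (\<Sum>j<n. \<Sum>k<j. ?q k * \<alpha> (j - k))"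
    by (subst hawkes_weight.simps) (simp add: sum.distrib)
  also have "(\<Sum>j<n. \<Sum>k<j. ?q k * \<alpha> (j - k)) = (\<Sum>k<n. \<Sum>j=Suc k..<n. ?q k * \<alpha> (j - k))"
    unfolding sum.Sigma[OF finite_lessThan, simplified]
    by (simp add: sum.Sigma)
       (rule sum.reindex_bij_witness[where i=prod.swap and j=prod.swap], auto)
  also have "\<dots> = (\<Sum>k<n. ?q k * (\<Sum>i<n - 1 - k. \<alpha> (Suc i)))"
  proof (rule sum.cong[OF refl])
    fix k assume k: "k \<in> {..<n}"
    have "(\<Sum>j=Suc k..<n. \<alpha> (j - k)) = (\<Sum>i<n - 1 - k. \<alpha> (Suc i))"
      by (rule sum.reindex_bij_witness[where i="\<lambda>i. i + Suc k" and j="\<lambda>j. j - Suc k"])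
         (use k in \<open>auto simp: Suc_diff_Suc\<close>)
    then show "(\<Sum>j=Suc k..<n. ?q k * \<alpha> (j - k)) = ?q k * (\<Sum>i<n - 1 - k. \<alpha> (Suc i))"
      by (simp only: sum_distrib_left[symmetric])
  qed
  finally show ?thesis .
qed

text \<open>The analysis of the recursion is kept free of probability: \<open>p\<close> stands for
  \<open>laplace_deficit\<close> and \<open>m\<close> for the mean mark.\<close>

context
  fixes p :: "real \<Rightarrow> real" and \<alpha> :: "nat \<Rightarrow> real" and m :: real
  assumes p_nonneg: "\<And>x. x \<ge> 0 \<Longrightarrow> p x \<ge> 0"
    and p_le: "\<And>x. x \<ge> 0 \<Longrightarrow> p x \<le> m * x"
    and alpha_ge0: "\<And>t. \<alpha> t \<ge> 0"
    and alpha_summable: "summable (\<lambda>t. \<alpha> (Suc t))"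
    and m_nonneg: "m \<ge> 0"
    and subcritical: "norm1 \<alpha> * m < 1"
begin

lemma norm1_partial_le: "(\<Sum>i<k. \<alpha> (Suc i)) \<le> norm1 \<alpha>"
  unfolding norm1_def using alpha_ge0 alpha_summable by (intro sum_le_suminf) auto

text \<open>The upper bound \<open>B\<close> is the fixed point of
  \<open>B = x + m * B * norm1 \<alpha>\<close>, so strong induction reproduces it exactly.\<close>

lemma hawkes_weight_bounds:
  assumes x: "x \<ge> 0"
  shows "hawkes_weight p \<alpha> x j \<in> {0..x / (1 - norm1 \<alpha> * m)}"
proof (induction j rule: less_induct)
  case (less j)
  define B where "B = x / (1 - norm1 \<alpha> * m)"
  have B: "B \<ge> 0" "x + m * B * norm1 \<alpha> = B"
    using x subcritical by (auto simp: B_def field_simps)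
  have q: "0 \<le> p (hawkes_weight p \<alpha> x k)" "p (hawkes_weight p \<alpha> x k) \<le> m * B" if "k < j" for k
  proof -
    have w: "0 \<le> hawkes_weight p \<alpha> x k" "hawkes_weight p \<alpha> x k \<le> B"
      using less[OF that] by (auto simp: B_def)
    show "0 \<le> p (hawkes_weight p \<alpha> x k)" using p_nonneg w by blast
    show "p (hawkes_weight p \<alpha> x k) \<le> m * B"
      using p_le[OF w(1)] mult_left_mono[OF w(2) m_nonneg] by linarith
  qed
  have "(\<Sum>k<j. p (hawkes_weight p \<alpha> x k) * \<alpha> (j - k)) \<le> (\<Sum>k<j. m * B * \<alpha> (j - k))"
    by (intro sum_mono mult_right_mono) (use q alpha_ge0 in auto)
  also have "\<dots> = m * B * (\<Sum>i<j. \<alpha> (Suc i))"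
    unfolding sum_distrib_left
    by (rule sum.reindex_bij_witness[where i="\<lambda>i. j - Suc i" and j="\<lambda>i. j - Suc i"]) (auto simp: Suc_diff_Suc)
  also have "\<dots> \<le> m * B * norm1 \<alpha>"
    by (intro mult_left_mono norm1_partial_le) (use m_nonneg B in auto)
  finally have "hawkes_weight p \<alpha> x j \<le> B"
    using B(2) by (subst hawkes_weight.simps) linarith
  moreover have "0 \<le> hawkes_weight p \<alpha> x j"
    by (subst hawkes_weight.simps) (intro add_nonneg_nonneg sum_nonneg mult_nonneg_nonneg x,
        use q alpha_ge0 in auto)
  ultimately show ?case by (simp add: B_def)
qed

text \<open>Up to the errors \<open>d\<close> and \<open>e\<close>, the sum \<open>S n\<close>
  solves the scalar equation \<open>S = m * (x + a * S)\<close>, whose solution is the limit. Both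
  errors vanish because all weights are at most \<open>b / n\<close>.\<close>

lemma sum_exponent_tendsto:
  assumes x: "x \<ge> 0"
    and gap_mono: "\<And>u v. 0 \<le> u \<Longrightarrow> u \<le> v \<Longrightarrow> m * u - p u \<le> m * v - p v"
    and p_deriv: "\<And>b. b \<ge> 0 \<Longrightarrow> (\<lambda>n. real n * p (b / real n)) \<longlonglongrightarrow> m * b"
  shows "(\<lambda>n. \<Sum>k<n. p (hawkes_weight p \<alpha> (x / n) k)) \<longlonglongrightarrow> m * x / (1 - norm1 \<alpha> * m)"
proof -
  define a where "a = norm1 \<alpha>"
  define b where "b = x / (1 - a * m)"
  define h where "h n k = hawkes_weight p \<alpha> (x / real n) k" for n k
  define A where "A k = (\<Sum>i<k. \<alpha> (Suc i))" for k
  define S where "S n = (\<Sum>k<n. p (h n k))" for n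
  \<comment> \<open>\<open>e\<close> is the linearisation error of \<open>p\<close>, \<open>d\<close> the boundary error from truncating \<open>norm1 \<alpha>\<close>.\<close>
  define e where "e n = (\<Sum>k<n. m * h n k - p (h n k))" for n
  define d where "d n = (\<Sum>k<n. p (h n k) * (a - A (n - 1 - k)))" for n
  have am: "1 - a * m > 0" using subcritical by (simp add: a_def)
  have b: "b \<ge> 0" using x am by (simp add: b_def)
  have h: "0 \<le> h n k" "h n k \<le> b / n" for n k
    using hawkes_weight_bounds[of "x / n" k] x by (auto simp: h_def b_def a_def mult.commute)
  have p: "0 \<le> p (h n k)" "p (h n k) \<le> m * (b / n)" for n k
    using p_nonneg[OF h(1)] p_le[OF h(1)[of n k]] mult_left_mono[OF h(2)[of n k] m_nonneg]
    by (blast, linarith)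
  have A: "A k \<le> a" for k by (simp add: A_def a_def norm1_partial_le)
  have "A \<longlonglongrightarrow> a"
    unfolding A_def[abs_def] a_def norm1_def by (rule summable_LIMSEQ[OF alpha_summable])
  then have "(\<lambda>k. a - A k) \<longlonglongrightarrow> a - a" by (intro tendsto_intros)
  then have ces: "(\<lambda>n. (\<Sum>k<n. a - A k) / n) \<longlonglongrightarrow> 0" by (intro cesaro_null) simp
  have "d \<longlonglongrightarrow> 0"
  proof (rule tendsto_sandwich[OF _ _ tendsto_const])
    show "\<forall>\<^sub>F n in sequentially. 0 \<le> d n"
      by (intro always_eventually allI) (auto simp: d_def intro!: sum_nonneg mult_nonneg_nonneg p A)
    \<comment> \<open>Each \<open>p (h n k)\<close> is at most \<open>m * b / n\<close>; after
      reversing the order of summation the rest is a Cesaro mean of the tails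
      \<open>a - A k\<close>.\<close>
    have "d n \<le> m * b * ((\<Sum>k<n. a - A k) / n)" for n
    proof -
      have "d n \<le> (\<Sum>k<n. m * (b / n) * (a - A (n - 1 - k)))"
        unfolding d_def by (intro sum_mono mult_right_mono p) (use A in auto)
      also have "\<dots> = (\<Sum>k<n. m * (b / n) * (a - A k))"
        by (rule sum.reindex_bij_witness[where i="\<lambda>i. n - Suc i" and j="\<lambda>i. n - Suc i"]) auto
      finally show ?thesis by (simp add: sum_distrib_left sum_divide_distrib)
    qed
    then show "\<forall>\<^sub>F n in sequentially. d n \<le> m * b * ((\<Sum>k<n. a - A k) / n)" by simp
    show "(\<lambda>n. m * b * ((\<Sum>k<n. a - A k) / n)) \<longlonglongrightarrow> 0"
      by (rule tendsto_mult_right_zero[OF ces])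
  qed
  have "e \<longlonglongrightarrow> 0"
  proof (rule tendsto_sandwich[OF _ _ tendsto_const])
    show "\<forall>\<^sub>F n in sequentially. 0 \<le> e n"
      by (intro always_eventually allI) (auto simp: e_def intro!: sum_nonneg p_le h)
    \<comment> \<open>By \<open>gap_mono\<close> each of the \<open>n\<close> gaps is largest at the
      common upper bound \<open>b / n\<close> of the weights.\<close>
    have *: "e n \<le> m * b - n * p (b / n)" if "n > 0" for n
    proof -
      have "e n \<le> real (card {..<n}) * (m * (b / n) - p (b / n))"
        unfolding e_def by (intro sum_bounded_above gap_mono h)
      then show ?thesis using that by (simp add: algebra_simps)
    qed
    show "\<forall>\<^sub>F n in sequentially. e n \<le> m * b - n * p (b / n)"
      by (rule eventually_mono[OF eventually_gt_at_top[of 0] *])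
    have "(\<lambda>n. m * b - n * p (b / n)) \<longlonglongrightarrow> m * b - m * b"
      by (intro tendsto_diff tendsto_const p_deriv b)
    then show "(\<lambda>n. m * b - n * p (b / n)) \<longlonglongrightarrow> 0" by simp
  qed
  \<comment> \<open>The sum of the weights is eliminated between the summed recursion and the
    definition of \<open>e\<close>.\<close>
  have S: "S n = (m * x - m * d n - e n) / (1 - a * m)" if "n > 0" for n
  proof -
    have "(\<Sum>k<n. h n k) = x + (\<Sum>k<n. p (h n k) * A (n - 1 - k))"
      unfolding h_def A_def using that by (subst sum_hawkes_weight) simp
    also have "\<dots> = x + a * S n - d n"
      by (simp add: d_def S_def sum_distrib_left right_diff_distrib sum_subtractf mult.commute)
    finally have H: "(\<Sum>k<n. h n k) = x + a * S n - d n" .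
    have "e n = m * (\<Sum>k<n. h n k) - S n"
      by (simp add: e_def S_def sum_subtractf sum_distrib_left)
    then show ?thesis unfolding H using am by (simp add: field_simps)
  qed
  have ev: "\<forall>\<^sub>F n in sequentially. (m * x - m * d n - e n) / (1 - a * m) = S n"
    by (rule eventually_mono[OF eventually_gt_at_top[of 0] S[symmetric]])
  have "(\<lambda>n. (m * x - m * d n - e n) / (1 - a * m)) \<longlonglongrightarrow> (m * x - m * 0 - 0) / (1 - a * m)"
    using am by (intro tendsto_intros \<open>d \<longlonglongrightarrow> 0\<close> \<open>e \<longlonglongrightarrow> 0\<close>) auto
  then have "S \<longlonglongrightarrow> (m * x - m * 0 - 0) / (1 - a * m)"
    using Lim_transform_eventually ev by blast
  then show ?thesis by (simp add: S_def[abs_def] h_def a_def)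
qed

end

subsection \<open>Laplace transforms and convergence in probability\<close>

text \<open>The transform at \<open>\<theta> = 1, 2\<close> already gives \<open>E[(exp(-Y\<^sub>n) - exp(-c))\<^sup>2] \<longrightarrow> 0\<close>.\<close>
lemma (in prob_space) tendsto_in_prob_laplace:
  fixes Y :: "nat \<Rightarrow> 'a \<Rightarrow> real"
  assumes Y: "\<And>n. Y n \<in> borel_measurable M"
    and nonneg: "\<And>n. AE \<omega> in M. Y n \<omega> \<ge> 0"
    and lap: "\<And>\<theta>. \<theta> > 0 \<Longrightarrow> (\<lambda>n. expectation (\<lambda>\<omega>. exp (- (\<theta> * Y n \<omega>)))) \<longlonglongrightarrow> exp (- (\<theta> * c))"
  shows "tendsto_in_prob M Y c"
  unfolding tendsto_in_prob_def
proof (intro allI impI)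
  fix \<epsilon> :: real assume \<epsilon>: "\<epsilon> > 0"
  \<comment> \<open>The distance from \<open>exp (- c)\<close> to
    \<open>exp (- (c + \<epsilon>))\<close>: the map \<open>exp (- y)\<close> is convex and
    decreasing, so the right-hand side of \<open>c\<close> gives the smaller gap.\<close>
  define \<delta> where "\<delta> = exp (- c) * (1 - exp (- \<epsilon>))"
  have \<delta>: "\<delta> > 0" using \<epsilon> by (simp add: \<delta>_def)
  have far: "\<delta> \<le> \<bar>exp (- y) - exp (- c)\<bar>" if "\<bar>y - c\<bar> > \<epsilon>" for y
  proof (cases "y > c")
    case True
    then have "exp (- y) \<le> exp (- c) * exp (- \<epsilon>)"
      using that by (simp add: exp_add[symmetric])
    then show ?thesis by (simp add: \<delta>_def right_diff_distrib)
  next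
    case False
    then have "exp (- c) * exp \<epsilon> \<le> exp (- y)"
      using that by (simp add: exp_add[symmetric])
    \<comment> \<open>Both \<open>1 - exp (- \<epsilon>) \<le> \<epsilon>\<close> and
      \<open>\<epsilon> \<le> exp \<epsilon> - 1\<close> are instances of
      \<open>1 + u \<le> exp u\<close>.\<close>
    moreover have "exp (- c) * (1 - exp (- \<epsilon>)) \<le> exp (- c) * (exp \<epsilon> - 1)"
      using exp_ge_add_one_self[of \<epsilon>] exp_ge_add_one_self[of "- \<epsilon>"]
      by (intro mult_left_mono) (linarith, simp)
    ultimately show ?thesis by (simp add: \<delta>_def right_diff_distrib)
  qed
  define V where "V n = expectation (\<lambda>\<omega>. (exp (- Y n \<omega>) - exp (- c))\<^sup>2)" for n
  note [measurable] = Y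
  have int: "integrable M (\<lambda>\<omega>. exp (- (\<theta> * Y n \<omega>)))" if "\<theta> > 0" for \<theta> n
  proof (rule integrable_const_bound[where B=1])
    show "AE \<omega> in M. norm (exp (- (\<theta> * Y n \<omega>))) \<le> 1"
      using nonneg[of n] by eventually_elim (use that in simp)
  qed measurable
  \<comment> \<open>The factor in \<open>1 * y\<close> is kept so that the terms match
    \<open>int\<close> and \<open>lap\<close> at \<open>\<theta> = 2\<close> and
    \<open>\<theta> = 1\<close>.\<close>
  have sq: "(exp (- y) - exp (- c))\<^sup>2
      = exp (- (2 * y)) - 2 * exp (- c) * exp (- (1 * y)) + (exp (- c))\<^sup>2" for y
    by (simp add: power2_eq_square algebra_simps exp_add[symmetric])
  have Vint: "integrable M (\<lambda>\<omega>. (exp (- Y n \<omega>) - exp (- c))\<^sup>2)" for n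
    unfolding sq by (intro Bochner_Integration.integrable_add Bochner_Integration.integrable_diff integrable_mult_right int) auto
  have V: "V n = expectation (\<lambda>\<omega>. exp (- (2 * Y n \<omega>)))
      - 2 * exp (- c) * expectation (\<lambda>\<omega>. exp (- (1 * Y n \<omega>))) + (exp (- c))\<^sup>2" for n
    unfolding V_def sq using int[of 2 n] int[of 1 n] by (simp add: prob_space)
  have "(\<lambda>n. expectation (\<lambda>\<omega>. exp (- (2 * Y n \<omega>)))
      - 2 * exp (- c) * expectation (\<lambda>\<omega>. exp (- (1 * Y n \<omega>))) + (exp (- c))\<^sup>2)
      \<longlonglongrightarrow> exp (- (2 * c)) - 2 * exp (- c) * exp (- (1 * c)) + (exp (- c))\<^sup>2"
    by (intro tendsto_intros lap) auto
  also have "exp (- (2 * c)) - 2 * exp (- c) * exp (- (1 * c)) + (exp (- c))\<^sup>2 = 0"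
    unfolding sq[of c, symmetric] by simp
  finally have V0: "V \<longlonglongrightarrow> 0" using V by (simp add: V[abs_def])
  show "(\<lambda>n. prob {\<omega> \<in> space M. \<bar>Y n \<omega> - c\<bar> > \<epsilon>}) \<longlonglongrightarrow> 0"
  proof (rule tendsto_sandwich[OF _ _ tendsto_const])
    \<comment> \<open>Markov's inequality for the squared difference, with threshold
      \<open>\<delta>\<^sup>2\<close>.\<close>
    have "prob {\<omega> \<in> space M. \<bar>Y n \<omega> - c\<bar> > \<epsilon>} \<le> V n / \<delta>\<^sup>2" for n
    proof -
      have "prob {\<omega> \<in> space M. \<bar>Y n \<omega> - c\<bar> > \<epsilon>}
          \<le> prob {\<omega> \<in> space M. \<delta>\<^sup>2 \<le> (exp (- Y n \<omega>) - exp (- c))\<^sup>2}"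
        using far \<delta> by (intro finite_measure_mono) (auto simp: abs_le_square_iff[symmetric])
      also have "\<dots> \<le> V n / \<delta>\<^sup>2"
        unfolding V_def by (rule integral_Markov_inequality_measure[where A="space M" and u="\<lambda>\<omega>. (exp (- Y n \<omega>) - exp (- c))\<^sup>2", simplified])
          (use Vint \<delta> in auto)
      finally show ?thesis .
    qed
    then show "\<forall>\<^sub>F n in sequentially. prob {\<omega> \<in> space M. \<bar>Y n \<omega> - c\<bar> > \<epsilon>} \<le> V n / \<delta>\<^sup>2" by simp
    show "(\<lambda>n. V n / \<delta>\<^sup>2) \<longlonglongrightarrow> 0"
      using tendsto_divide[OF V0 tendsto_const[of "\<delta>\<^sup>2"]] \<delta> by simp
  qed simp
qed


lemma vimage_algebra_sets_subset: "sets (vimage_algebra S f N) \<subseteq> Pow S"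
  using sets.space_closed[of "vimage_algebra S f N"] by simp

text \<open>The Poisson generating function at \<open>q\<close>: the exponential series of
  \<open>r * q\<close>, scaled by \<open>exp (- r)\<close>.\<close>

lemma poisson_generating_sums:
  "(\<lambda>k. r ^ k / fact k * exp (- r) * q ^ k) sums exp (- (r * (1 - q)))" for r q :: real
proof -
  have "(\<lambda>k. (r * q) ^ k /\<^sub>R fact k * exp (- r)) sums (exp (r * q) * exp (- r))"
    by (intro sums_mult2 exp_converges)
  moreover have "(r * q) ^ k /\<^sub>R fact k * exp (- r) = r ^ k / fact k * exp (- r) * q ^ k" for k
    by (simp add: power_mult_distrib field_simps)
  moreover have "exp (r * q) * exp (- r) = exp (- (r * (1 - q)))"
    by (simp add: exp_add[symmetric] algebra_simps)
  ultimately show ?thesis by simp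
qed

subsection \<open>The Laplace transform of the process\<close>

context marked_hawkes
begin

section \<open>Laplace transform of a single mark\<close>

text \<open>The Laplace exponent of the compound Poisson law of the marks per unit of intensity; it
  takes the place of \<open>p\<close> in \<open>hawkes_weight\<close>.\<close>

definition laplace_deficit :: "real \<Rightarrow> real" where
  "laplace_deficit x = 1 - expectation (\<lambda>\<omega>. exp (- (x * ell 1 1 \<omega>)))"

lemma mark_laplace_integrable:
  assumes "t \<ge> 1" "j \<ge> 1" "x \<ge> 0"
  shows "integrable M (\<lambda>\<omega>. exp (- (x * ell t j \<omega>)))"
proof (rule integrable_const_bound[where B=1])
  note [measurable] = mark_measurable[OF assms(1,2)]
  show "AE \<omega> in M. norm (exp (- (x * ell t j \<omega>))) \<le> 1"
    using marks_pos[OF assms(1,2)] by eventually_elim (use assms(3) in simp)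
  show "(\<lambda>\<omega>. exp (- (x * ell t j \<omega>))) \<in> borel_measurable M" by measurable
qed

lemma mark_laplace:
  assumes "t \<ge> 1" "j \<ge> 1"
  shows "expectation (\<lambda>\<omega>. exp (- (x * ell t j \<omega>))) = 1 - laplace_deficit x"
proof -
  have "expectation (\<lambda>\<omega>. exp (- (x * ell t j \<omega>))) = (\<integral>y. exp (- (x * y)) \<partial>distr M borel (ell t j))"
    using mark_measurable[OF assms] by (simp add: integral_distr)
  also have "\<dots> = expectation (\<lambda>\<omega>. exp (- (x * ell 1 1 \<omega>)))"
    unfolding marks_ident[OF assms] using mark_measurable[of 1 1] by (simp add: integral_distr)
  finally show ?thesis by (simp add: laplace_deficit_def)
qed

lemma marks_sum_laplace:
  assumes t: "t \<ge> 1" and x: "x \<ge> 0"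
  shows "expectation (\<lambda>\<omega>. exp (- (x * (\<Sum>j=1..k. ell t j \<omega>)))) = (1 - laplace_deficit x) ^ k"
proof -
  \<comment> \<open>Independence of the marks is stated for pairs, hence the index set
    \<open>{t} \<times> {1..k}\<close>, reindexed to \<open>j\<close> at the end.\<close>
  let ?f = "\<lambda>i \<omega>. exp (- (x * (case i of (t, j) \<Rightarrow> ell t j) \<omega>))"
  have "indep_vars (\<lambda>_. borel) ?f ({t} \<times> {1..k})"
    using t by (intro indep_vars_compose2[OF indep_vars_subset[OF marks_indep]]) auto
  moreover have "integrable M (?f i)" if "i \<in> {t} \<times> {1..k}" for i
    using that t mark_laplace_integrable[OF _ _ x] by auto
  ultimately have "expectation (\<lambda>\<omega>. \<Prod>i\<in>{t} \<times> {1..k}. ?f i \<omega>) = (\<Prod>i\<in>{t} \<times> {1..k}. expectation (?f i))"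
    by (intro indep_vars_lebesgue_integral) auto
  also have "\<dots> = (\<Prod>i\<in>{t} \<times> {1..k}. 1 - laplace_deficit x)"
    using t by (intro prod.cong) (auto simp: mark_laplace)
  also have "(\<lambda>\<omega>. \<Prod>i\<in>{t} \<times> {1..k}. ?f i \<omega>) = (\<lambda>\<omega>. \<Prod>j=1..k. exp (- (x * ell t j \<omega>)))"
    by (intro ext prod.reindex_bij_witness[where i="Pair t" and j=snd]) auto
  also have "\<dots> = (\<lambda>\<omega>. exp (- (x * (\<Sum>j=1..k. ell t j \<omega>))))"
    by (simp add: sum_distrib_left sum_negf[symmetric] exp_sum)
  finally show ?thesis by simp
qed

lemma mark_expectation_nonneg: "expectation (ell 1 1) \<ge> 0"
  using marks_pos[of 1 1] by (intro integral_nonneg_AE) auto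

text \<open>Integrates \<open>1 - y \<le> exp (- y) \<le> 1\<close> at
  \<open>y = x * ell 1 1 \<omega>\<close>; the bound by 1 uses that the transform is
  nonnegative.\<close>

lemma laplace_deficit_bounds:
  assumes x: "x \<ge> 0"
  shows "0 \<le> laplace_deficit x" "laplace_deficit x \<le> 1"
    "laplace_deficit x \<le> expectation (ell 1 1) * x"
proof -
  note int = mark_laplace_integrable[OF order_refl order_refl x]
  have "expectation (\<lambda>\<omega>. exp (- (x * ell 1 1 \<omega>))) \<le> expectation (\<lambda>_. 1)"
    by (intro integral_mono_AE int) (use marks_pos[of 1 1] x int in auto)
  then show "0 \<le> laplace_deficit x" by (simp add: laplace_deficit_def prob_space)
  show "laplace_deficit x \<le> 1" by (simp add: laplace_deficit_def)
  have "expectation (\<lambda>\<omega>. 1 - x * ell 1 1 \<omega>) \<le> expectation (\<lambda>\<omega>. exp (- (x * ell 1 1 \<omega>)))"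
    using exp_ge_add_one_self[of "- (x * ell 1 1 _)"] marks_integrable
    by (intro integral_mono int) auto
  then show "laplace_deficit x \<le> expectation (ell 1 1) * x"
    using marks_integrable by (simp add: laplace_deficit_def prob_space mult.commute)
qed

text \<open>The gap is the expectation of \<open>y + exp (- y) - 1\<close> at
  \<open>y = x * ell 1 1 \<omega>\<close>, and this function is nondecreasing for
  \<open>y \<ge> 0\<close>.\<close>

lemma laplace_deficit_gap_mono:
  assumes u: "0 \<le> u" "u \<le> v"
  shows "expectation (ell 1 1) * u - laplace_deficit u \<le> expectation (ell 1 1) * v - laplace_deficit v"
proof -
  have gap: "expectation (ell 1 1) * x - laplace_deficit x
      = expectation (\<lambda>\<omega>. x * ell 1 1 \<omega> + exp (- (x * ell 1 1 \<omega>))) - 1" if "x \<ge> 0" for x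
    using mark_laplace_integrable[of 1 1, OF _ _ that] marks_integrable
    by (simp add: laplace_deficit_def)
  have "expectation (\<lambda>\<omega>. u * ell 1 1 \<omega> + exp (- (u * ell 1 1 \<omega>)))
      \<le> expectation (\<lambda>\<omega>. v * ell 1 1 \<omega> + exp (- (v * ell 1 1 \<omega>)))"
  proof (rule integral_mono_AE)
    show "AE \<omega> in M. u * ell 1 1 \<omega> + exp (- (u * ell 1 1 \<omega>)) \<le> v * ell 1 1 \<omega> + exp (- (v * ell 1 1 \<omega>))"
      using marks_pos[OF order_refl order_refl]
    proof eventually_elim
      fix \<omega> assume pos: "ell 1 1 \<omega> > 0"
      define s d where "s = u * ell 1 1 \<omega>" and "d = (v - u) * ell 1 1 \<omega>"
      have sd: "s \<ge> 0" "d \<ge> 0" using u pos by (auto simp: s_def d_def)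
      have "exp (- s) - exp (- (s + d)) = exp (- s) * (1 - exp (- d))"
        by (simp add: right_diff_distrib exp_add[symmetric])
      also have "\<dots> \<le> 1 * (1 - exp (- d))" using sd by (intro mult_right_mono) auto
      also have "\<dots> \<le> d" using exp_ge_add_one_self[of "- d"] by simp
      finally show "u * ell 1 1 \<omega> + exp (- (u * ell 1 1 \<omega>)) \<le> v * ell 1 1 \<omega> + exp (- (v * ell 1 1 \<omega>))"
        by (simp add: s_def d_def algebra_simps)
    qed
  qed (use mark_laplace_integrable[of 1 1] marks_integrable u in auto)
  then show ?thesis unfolding gap[OF u(1)] gap[OF order_trans[OF u]] by simp
qed

text \<open>The right derivative at 0 is the mean mark, by dominated convergence:
  \<open>1 - exp (- y) \<le> y\<close> makes \<open>b * ell 1 1\<close> a dominating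
  function.\<close>

lemma laplace_deficit_deriv:
  assumes b: "b \<ge> 0"
  shows "(\<lambda>n. real n * laplace_deficit (b / real n)) \<longlonglongrightarrow> expectation (ell 1 1) * b"
proof -
  note [measurable] = mark_measurable[OF order_refl order_refl]
  have "(\<lambda>n. expectation (\<lambda>\<omega>. real n * (1 - exp (- (b / real n * ell 1 1 \<omega>)))))
      \<longlonglongrightarrow> expectation (\<lambda>\<omega>. b * ell 1 1 \<omega>)"
  proof (rule integral_dominated_convergence[where w="\<lambda>\<omega>. b * ell 1 1 \<omega>"])
    show "integrable M (\<lambda>\<omega>. b * ell 1 1 \<omega>)" using marks_integrable by simp
    have "(\<lambda>n. real n * (1 - exp (- (b / real n * y)))) \<longlonglongrightarrow> b * y" for y by real_asymp
    then show "AE \<omega> in M. (\<lambda>n. real n * (1 - exp (- (b / real n * ell 1 1 \<omega>)))) \<longlonglongrightarrow> b * ell 1 1 \<omega>"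
      by simp
    fix n
    show "AE \<omega> in M. norm (real n * (1 - exp (- (b / real n * ell 1 1 \<omega>)))) \<le> b * ell 1 1 \<omega>"
      using marks_pos[OF order_refl order_refl]
    proof eventually_elim
      fix \<omega> assume pos: "ell 1 1 \<omega> > 0"
      define y where "y = b / real n * ell 1 1 \<omega>"
      have y: "y \<ge> 0" using b pos by (simp add: y_def)
      have "real n * (1 - exp (- y)) \<le> real n * y"
        using exp_ge_add_one_self[of "- y"] by (intro mult_left_mono) auto
      \<comment> \<open>Equality for positive \<open>n\<close>; at \<open>n = 0\<close> division by
        zero makes the left side 0.\<close>
      also have "\<dots> \<le> b * ell 1 1 \<omega>" using b pos by (simp add: y_def)
      finally show "norm (real n * (1 - exp (- (b / real n * ell 1 1 \<omega>)))) \<le> b * ell 1 1 \<omega>"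
        using y by (simp add: y_def abs_mult)
    qed
  qed measurable
  moreover have "expectation (\<lambda>\<omega>. real n * (1 - exp (- (b / real n * ell 1 1 \<omega>))))
      = real n * laplace_deficit (b / real n)" for n
    using mark_laplace_integrable[of 1 1 "b / real n"] b
    by (simp add: laplace_deficit_def prob_space)
  ultimately have "(\<lambda>n. real n * laplace_deficit (b / real n)) \<longlonglongrightarrow> expectation (\<lambda>\<omega>. b * ell 1 1 \<omega>)"
    by (simp only:)
  then show ?thesis using marks_integrable by (simp add: mult.commute)
qed

section \<open>Positivity, measurability and independence from the past\<close>

lemma marks_all_pos: "AE \<omega> in M. \<forall>t\<ge>1. \<forall>j\<ge>1. ell t j \<omega> > 0"
  using marks_pos by (auto simp: AE_all_countable)

lemma hawkes_X_nonneg: "AE \<omega> in M. \<forall>t. hawkes_X ell Z t \<omega> \<ge> 0"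
  using marks_all_pos by eventually_elim (auto simp: hawkes_X_def less_imp_le intro!: sum_nonneg)

lemma hawkes_intensity_ge: "AE \<omega> in M. hawkes_intensity \<nu> \<alpha> ell Z t \<omega> \<ge> \<nu>"
  using hawkes_X_nonneg
  by eventually_elim (auto simp: hawkes_intensity_def intro!: sum_nonneg mult_nonneg_nonneg alpha_nonneg)

lemma hawkes_X_filtration_measurable:
  assumes "s \<in> {1..t}"
  shows "hawkes_X ell Z s \<in> borel_measurable (hawkes_filtration M ell Z t)"
proof (rule measurableI)
  have sp: "space (hawkes_filtration M ell Z t) = space M"
    using hawkes_filtration_subalgebra by (auto simp: subalgebra_def)
  fix A :: "real set" assume "A \<in> sets borel"
  let ?G = "\<Union>s\<in>{1..t}. sets (vimage_algebra (space M) (Z s) (count_space UNIV)) \<union>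
                  sets (vimage_algebra (space M) (hawkes_X ell Z s) borel)"
  have "?G \<subseteq> Pow (space M)"
    by (intro UN_least Un_least vimage_algebra_sets_subset)
  moreover have "hawkes_X ell Z s -` A \<inter> space M \<in> ?G"
    by (rule UN_I[OF assms], rule UnI2, rule in_vimage_algebra) fact
  ultimately show "hawkes_X ell Z s -` A \<inter> space (hawkes_filtration M ell Z t)
      \<in> sets (hawkes_filtration M ell Z t)"
    unfolding sp by (simp add: hawkes_filtration_def)
qed simp

lemma
  assumes t: "t \<ge> 1"
  shows space_hawkes_past: "space (hawkes_past M ell Z t) = space M"
    and filtration_subset_past: "sets (hawkes_filtration M ell Z (t - 1)) \<subseteq> sets (hawkes_past M ell Z t)"
    and Z_event_in_past: "{\<omega> \<in> space M. Z t \<omega> = k} \<in> sets (hawkes_past M ell Z t)"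
proof -
  let ?G = "sets (hawkes_filtration M ell Z (t - 1)) \<union>
      sets (vimage_algebra (space M) (Z t) (count_space UNIV))"
  have G: "?G \<subseteq> Pow (space M)"
    using sets.space_closed[of "hawkes_filtration M ell Z (t - 1)"]
      hawkes_filtration_subalgebra[of "t - 1"]
    by (intro Un_least vimage_algebra_sets_subset) (simp add: subalgebra_def)
  show "space (hawkes_past M ell Z t) = space M" by (simp add: hawkes_past_def space_measure_of_conv)
  have sets: "?G \<subseteq> sets (hawkes_past M ell Z t)"
    unfolding hawkes_past_def using G by (auto simp: sets_measure_of)
  then show "sets (hawkes_filtration M ell Z (t - 1)) \<subseteq> sets (hawkes_past M ell Z t)" by blast
  have "Z t -` {k} \<inter> space M \<in> sets (vimage_algebra (space M) (Z t) (count_space UNIV))"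
    by (rule in_vimage_algebra) simp
  moreover have "Z t -` {k} \<inter> space M = {\<omega> \<in> space M. Z t \<omega> = k}" by auto
  ultimately show "{\<omega> \<in> space M. Z t \<omega> = k} \<in> sets (hawkes_past M ell Z t)"
    using sets by auto
qed

lemma mark_algebra_measurable:
  assumes "j \<ge> 1"
  shows "ell t j \<in> borel_measurable (mark_algebra M ell t)"
proof (rule measurableI)
  have sp: "space (mark_algebra M ell t) = space M" by (simp add: mark_algebra_def space_measure_of_conv)
  fix A :: "real set" assume "A \<in> sets borel"
  let ?G = "\<Union>j\<in>{1..}. sets (vimage_algebra (space M) (ell t j) borel)"
  have "?G \<subseteq> Pow (space M)"
    by (intro UN_least Un_least vimage_algebra_sets_subset)
  moreover have "ell t j -` A \<inter> space M \<in> ?G"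
    by (rule UN_I[of j], use assms in simp, rule in_vimage_algebra) fact
  ultimately show "ell t j -` A \<inter> space (mark_algebra M ell t) \<in> sets (mark_algebra M ell t)"
    unfolding sp by (simp add: mark_algebra_def)
qed simp

text \<open>Functions measurable for two independent sigma-algebras generate smaller ones, which
  inherit the independence.\<close>

lemma indep_marks_past:
  assumes t: "t \<ge> 1"
    and X: "X \<in> borel_measurable (hawkes_past M ell Z t)"
    and Y: "Y \<in> borel_measurable (mark_algebra M ell t)"
  shows "indep_var borel (X :: 'a \<Rightarrow> real) borel (Y :: 'a \<Rightarrow> real)"
proof -
  note ind = marks_indep_past[OF t]
  have sp: "space (hawkes_past M ell Z t) = space M" "space (mark_algebra M ell t) = space M"
    by (simp_all add: hawkes_past_def mark_algebra_def space_measure_of_conv)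
  have gen: "sigma_sets (space M) {f -` A \<inter> space M | A. A \<in> sets borel} \<subseteq> sets N"
    if "f \<in> borel_measurable N" "space N = space M" for f :: "'a \<Rightarrow> real" and N :: "'a measure"
    using measurable_sets[OF that(1)] that(2)
      sets.sigma_sets_subset[of "{f -` A \<inter> space M | A. A \<in> sets borel}" N] by auto
  note GX = gen[OF X sp(1)] and GY = gen[OF Y sp(2)]
  have rv: "f \<in> borel_measurable M"
    if "f \<in> borel_measurable N" "space N = space M" "sets N \<subseteq> sets M" for f :: "'a \<Rightarrow> real" and N :: "'a measure"
    using that by (auto simp: measurable_def)
  show ?thesis
    unfolding indep_var_eq
  proof (intro conjI)
    show "random_variable borel X" using rv[OF X sp(1)] indep_setD_ev2[OF ind] by blast
    show "random_variable borel Y" using rv[OF Y sp(2)] indep_setD_ev1[OF ind] by blast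
    show "indep_set (sigma_sets (space M) {X -` A \<inter> space M | A. A \<in> sets borel})
        (sigma_sets (space M) {Y -` A \<inter> space M | A. A \<in> sets borel})"
      unfolding indep_sets2_eq
    proof (intro conjI ballI)
      fix a b assume a: "a \<in> sigma_sets (space M) {X -` A \<inter> space M | A. A \<in> sets borel}"
        and b: "b \<in> sigma_sets (space M) {Y -` A \<inter> space M | A. A \<in> sets borel}"
      have "prob (b \<inter> a) = prob b * prob a"
        by (rule indep_setD[OF ind subsetD[OF GY b] subsetD[OF GX a]])
      then show "prob (a \<inter> b) = prob a * prob b" by (simp add: Int_commute)
    qed (use GX GY indep_setD_ev1[OF ind] indep_setD_ev2[OF ind] in \<open>auto dest: subsetD\<close>)
  qed
qed

section \<open>Conditioning on one time step\<close>

text \<open>On the event that Z_t is \<open>k\<close>, the increment is a sum of exactly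
  \<open>k\<close> marks. Independence from the past splits off
  \<open>(1 - laplace_deficit x) ^ k\<close>, and conditioning on the filtration turns the event
  into its Poisson weight.\<close>

lemma laplace_step_on_event:
  assumes t: "t \<ge> 1" and x: "x \<ge> 0"
    and W: "W \<in> borel_measurable (hawkes_filtration M ell Z (t - 1))"
    and W01: "AE \<omega> in M. W \<omega> \<in> {0..1}"
  shows "expectation (\<lambda>\<omega>. W \<omega> * exp (- (x * hawkes_X ell Z t \<omega>)) * indicator {\<omega>. Z t \<omega> = k} \<omega>)
    = expectation (\<lambda>\<omega>. W \<omega> * (hawkes_intensity \<nu> \<alpha> ell Z t \<omega> ^ k / fact k
        * exp (- hawkes_intensity \<nu> \<alpha> ell Z t \<omega>) * (1 - laplace_deficit x) ^ k))"
proof -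
  let ?F = "hawkes_filtration M ell Z (t - 1)"
  \<comment> \<open>The Poisson weights are written out because \<^const>\<open>poisson_pmf\<close> is unspecified at
    non-positive rates, where its measurability in the rate is not available.\<close>
  let ?I = "hawkes_intensity \<nu> \<alpha> ell Z t"
  note [measurable] = hawkes_X_measurable
  have [measurable]: "?I \<in> borel_measurable M"
    unfolding hawkes_intensity_def[abs_def] by measurable
  define A where "A = {\<omega> \<in> space M. Z t \<omega> = k}"
  have A[measurable]: "A \<in> sets M" "A \<in> sets (hawkes_past M ell Z t)"
    using measurable_sets[OF Z_measurable[OF t], of "{k}"] Z_event_in_past[OF t]
    by (auto simp: A_def vimage_def Int_def conj_commute)
  have WM[measurable]: "W \<in> borel_measurable M"
    by (rule measurable_from_subalg[OF hawkes_filtration_subalgebra W])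
  have "W \<in> borel_measurable (hawkes_past M ell Z t)"
    by (rule measurable_from_subalg[OF _ W])
      (use space_hawkes_past[OF t] filtration_subset_past[OF t] hawkes_filtration_subalgebra[of "t - 1"] in \<open>auto simp: subalgebra_def\<close>)
  then have mW: "(\<lambda>\<omega>. W \<omega> * indicator A \<omega>) \<in> borel_measurable (hawkes_past M ell Z t)" by measurable
  have mY: "(\<lambda>\<omega>. exp (- (x * (\<Sum>j=1..k. ell t j \<omega>)))) \<in> borel_measurable (mark_algebra M ell t)"
  proof -
    have [measurable]: "(\<lambda>\<omega>. \<Sum>j=1..k. ell t j \<omega>) \<in> borel_measurable (mark_algebra M ell t)"
      by (rule borel_measurable_sum) (auto intro: mark_algebra_measurable)
    show ?thesis by measurable
  qed
  have iW: "integrable M (\<lambda>\<omega>. W \<omega> * indicator A \<omega>)"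
  proof (rule integrable_const_bound[where B=1])
    show "AE \<omega> in M. norm (W \<omega> * indicator A \<omega>) \<le> 1"
      using W01 by eventually_elim (auto split: split_indicator)
  qed measurable
  have iY: "integrable M (\<lambda>\<omega>. exp (- (x * (\<Sum>j=1..k. ell t j \<omega>))))"
  proof (rule integrable_const_bound[where B=1])
    show "AE \<omega> in M. norm (exp (- (x * (\<Sum>j=1..k. ell t j \<omega>)))) \<le> 1"
      using marks_all_pos
      by eventually_elim (use t x in \<open>auto intro!: mult_nonneg_nonneg sum_nonneg simp: less_imp_le\<close>)
    have [measurable]: "(\<lambda>\<omega>. \<Sum>j=1..k. ell t j \<omega>) \<in> borel_measurable M"
      by (rule borel_measurable_sum) (use t in \<open>auto intro: mark_measurable\<close>)
    show "(\<lambda>\<omega>. exp (- (x * (\<Sum>j=1..k. ell t j \<omega>)))) \<in> borel_measurable M"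
      by measurable
  qed
  have "expectation (\<lambda>\<omega>. W \<omega> * exp (- (x * hawkes_X ell Z t \<omega>)) * indicator {\<omega>. Z t \<omega> = k} \<omega>)
      = expectation (\<lambda>\<omega>. (W \<omega> * indicator A \<omega>) * exp (- (x * (\<Sum>j=1..k. ell t j \<omega>))))"
    using t by (intro Bochner_Integration.integral_cong)
      (auto simp: A_def hawkes_X_def split: split_indicator)
  also have "\<dots> = expectation (\<lambda>\<omega>. W \<omega> * indicator A \<omega>) * (1 - laplace_deficit x) ^ k"
    by (simp only: indep_var_lebesgue_integral[OF indep_marks_past[OF t mW mY] iW iY]
        marks_sum_laplace[OF t x])
  \<comment> \<open>Since \<open>W\<close> is measurable for the filtration at \<open>t - 1\<close>,
    the indicator may be replaced by its conditional expectation.\<close>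
  also have "expectation (\<lambda>\<omega>. W \<omega> * indicator A \<omega>)
      = expectation (\<lambda>\<omega>. W \<omega> * real_cond_exp M ?F (indicator A) \<omega>)"
  proof -
    interpret finite_measure_subalgebra M ?F
      by unfold_locales (rule hawkes_filtration_subalgebra)
    show ?thesis by (rule real_cond_exp_intg(2)[symmetric, OF iW W]) simp
  qed
  also have "\<dots> = expectation (\<lambda>\<omega>. W \<omega> * (?I \<omega> ^ k / fact k * exp (- ?I \<omega>)))"
  proof (rule integral_cong_AE)
    show "AE \<omega> in M. W \<omega> * real_cond_exp M ?F (indicator A) \<omega>
        = W \<omega> * (?I \<omega> ^ k / fact k * exp (- ?I \<omega>))"
      using Z_cond[OF t, of k] hawkes_intensity_ge[of t] unfolding A_def
      by eventually_elim (use nu_pos in simp)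
  qed measurable
  finally show ?thesis by (simp add: mult.assoc[symmetric])
qed

text \<open>Sums the previous identity over \<open>k\<close>. On the left the events partition the
  space; on the right the Poisson generating function appears. Both limits are dominated by the
  constant 1.\<close>

lemma laplace_step:
  assumes t: "t \<ge> 1" and x: "x \<ge> 0"
    and W: "W \<in> borel_measurable (hawkes_filtration M ell Z (t - 1))"
    and W01: "AE \<omega> in M. W \<omega> \<in> {0..1}"
  shows "expectation (\<lambda>\<omega>. W \<omega> * exp (- (x * hawkes_X ell Z t \<omega>)))
    = expectation (\<lambda>\<omega>. W \<omega> * exp (- (hawkes_intensity \<nu> \<alpha> ell Z t \<omega> * laplace_deficit x)))"
proof -
  let ?X = "\<lambda>\<omega>. W \<omega> * exp (- (x * hawkes_X ell Z t \<omega>))"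
  let ?q = "1 - laplace_deficit x"
  let ?I = "hawkes_intensity \<nu> \<alpha> ell Z t"
  let ?P = "\<lambda>\<omega> k. ?I \<omega> ^ k / fact k * exp (- ?I \<omega>) * ?q ^ k"
  have q: "0 \<le> ?q" "?q \<le> 1" using laplace_deficit_bounds[OF x] by auto
  note [measurable] = measurable_from_subalg[OF hawkes_filtration_subalgebra W]
    hawkes_X_measurable Z_measurable[OF t]
  have [measurable]: "?I \<in> borel_measurable M"
    unfolding hawkes_intensity_def[abs_def] by measurable
  have Isums: "AE \<omega> in M. ?P \<omega> sums exp (- (?I \<omega> * laplace_deficit x)) \<and> (\<forall>k. ?P \<omega> k \<ge> 0)"
    using hawkes_intensity_ge[of t]
  proof eventually_elim
    fix \<omega> assume "\<nu> \<le> ?I \<omega>"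
    then have "?I \<omega> > 0" using nu_pos by simp
    with poisson_generating_sums[of "?I \<omega>" ?q] q
    show "?P \<omega> sums exp (- (?I \<omega> * laplace_deficit x)) \<and> (\<forall>k. ?P \<omega> k \<ge> 0)" by simp
  qed
  have XI: "AE \<omega> in M. norm (?X \<omega>) \<le> 1"
    using W01 hawkes_X_nonneg
    by eventually_elim (auto simp: abs_mult x intro!: mult_le_one)
  have iX: "integrable M (\<lambda>\<omega>. ?X \<omega> * indicator {\<omega>. Z t \<omega> = k} \<omega>)" for k
  proof (rule integrable_const_bound[where B=1])
    show "AE \<omega> in M. norm (?X \<omega> * indicator {\<omega>. Z t \<omega> = k} \<omega>) \<le> 1"
      using XI by eventually_elim (auto split: split_indicator)
  qed measurable
  \<comment> \<open>Partial sums of the nonnegative series are at most its sum, which is at most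
    1.\<close>
  have Pbound: "AE \<omega> in M. \<forall>n. norm (\<Sum>k<n. W \<omega> * ?P \<omega> k) \<le> 1"
    using W01 Isums hawkes_intensity_ge[of t]
  proof eventually_elim
    fix \<omega> assume w: "W \<omega> \<in> {0..1}" and s: "?P \<omega> sums exp (- (?I \<omega> * laplace_deficit x)) \<and> (\<forall>k. ?P \<omega> k \<ge> 0)"
      and I: "\<nu> \<le> ?I \<omega>"
    show "\<forall>n. norm (\<Sum>k<n. W \<omega> * ?P \<omega> k) \<le> 1"
    proof
      fix n
      have 0: "0 \<le> (\<Sum>k<n. ?P \<omega> k)" using s by (intro sum_nonneg) auto
      have "(\<Sum>k<n. ?P \<omega> k) \<le> (\<Sum>k. ?P \<omega> k)"
        using s by (intro sum_le_suminf) (auto simp: sums_iff)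
      also have "\<dots> = exp (- (?I \<omega> * laplace_deficit x))"
        using s by (simp add: sums_iff)
      also have "\<dots> \<le> 1" using I nu_pos laplace_deficit_bounds(1)[OF x] by simp
      finally have 1: "(\<Sum>k<n. ?P \<omega> k) \<le> 1" .
      show "norm (\<Sum>k<n. W \<omega> * ?P \<omega> k) \<le> 1"
        unfolding sum_distrib_left[symmetric] norm_mult by (intro mult_le_one) (use w 0 1 in auto)
    qed
  qed
  \<comment> \<open>A single term is the difference of two consecutive partial sums, hence the bound
    2.\<close>
  have iP: "integrable M (\<lambda>\<omega>. W \<omega> * ?P \<omega> k)" for k
  proof (rule integrable_const_bound[where B=2])
    show "AE \<omega> in M. norm (W \<omega> * ?P \<omega> k) \<le> 2"
      using Pbound
    proof eventually_elim
      fix \<omega> assume "\<forall>n. norm (\<Sum>k<n. W \<omega> * ?P \<omega> k) \<le> 1"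
      from this[rule_format, of k] this[rule_format, of "Suc k"]
      show "norm (W \<omega> * ?P \<omega> k) \<le> 2"
        unfolding sum.lessThan_Suc real_norm_def by linarith
    qed
  qed measurable
  have "(\<lambda>n. expectation (\<lambda>\<omega>. \<Sum>k<n. ?X \<omega> * indicator {\<omega>. Z t \<omega> = k} \<omega>)) \<longlonglongrightarrow> expectation ?X"
  proof (rule integral_dominated_convergence[where w="\<lambda>_. 1"])
    \<comment> \<open>The partial sum cuts \<open>?X\<close> off where Z_t is at least
      \<open>n\<close>, so it is eventually constant at each point.\<close>
    have sum: "(\<Sum>k<n. ?X \<omega> * indicator {\<omega>. Z t \<omega> = k} \<omega>) = (if Z t \<omega> < n then ?X \<omega> else 0)" for n \<omega>
      by (simp add: indicator_def of_bool_def if_distrib[of "\<lambda>c. _ * c"] cong: if_cong)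
    show "AE \<omega> in M. (\<lambda>n. \<Sum>k<n. ?X \<omega> * indicator {\<omega>. Z t \<omega> = k} \<omega>) \<longlonglongrightarrow> ?X \<omega>"
    proof (rule AE_I2, unfold sum, rule tendsto_eventually)
      fix \<omega>
      show "\<forall>\<^sub>F n in sequentially. (if Z t \<omega> < n then ?X \<omega> else 0) = ?X \<omega>"
        using eventually_gt_at_top[of "Z t \<omega>"] by eventually_elim simp
    qed
    show "AE \<omega> in M. norm (\<Sum>k<n. ?X \<omega> * indicator {\<omega>. Z t \<omega> = k} \<omega>) \<le> 1" for n
      using XI unfolding sum by eventually_elim auto
  qed measurable
  moreover have "(\<lambda>n. expectation (\<lambda>\<omega>. \<Sum>k<n. W \<omega> * ?P \<omega> k))
      \<longlonglongrightarrow> expectation (\<lambda>\<omega>. W \<omega> * exp (- (?I \<omega> * laplace_deficit x)))"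
  proof (rule integral_dominated_convergence[where w="\<lambda>_. 1"])
    show "AE \<omega> in M. (\<lambda>n. \<Sum>k<n. W \<omega> * ?P \<omega> k) \<longlonglongrightarrow> W \<omega> * exp (- (?I \<omega> * laplace_deficit x))"
      using Isums
    proof eventually_elim
      fix \<omega> assume "?P \<omega> sums exp (- (?I \<omega> * laplace_deficit x)) \<and> (\<forall>k. ?P \<omega> k \<ge> 0)"
      then have "(\<lambda>k. W \<omega> * ?P \<omega> k) sums (W \<omega> * exp (- (?I \<omega> * laplace_deficit x)))"
        by (intro sums_mult) simp
      then show "(\<lambda>n. \<Sum>k<n. W \<omega> * ?P \<omega> k) \<longlonglongrightarrow> W \<omega> * exp (- (?I \<omega> * laplace_deficit x))"
        by (simp add: sums_def)
    qed
    show "AE \<omega> in M. norm (\<Sum>k<n. W \<omega> * ?P \<omega> k) \<le> 1" for n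
      using Pbound by eventually_elim simp
  qed measurable
  moreover have "expectation (\<lambda>\<omega>. \<Sum>k<n. ?X \<omega> * indicator {\<omega>. Z t \<omega> = k} \<omega>)
      = expectation (\<lambda>\<omega>. \<Sum>k<n. W \<omega> * ?P \<omega> k)" for n
    by (simp only: Bochner_Integration.integral_sum[OF iX] Bochner_Integration.integral_sum[OF iP]
        laplace_step_on_event[OF t x W W01])
  ultimately show ?thesis by (simp add: LIMSEQ_unique)
qed

section \<open>Backward iteration over the path\<close>

text \<open>With the earlier exponentials as \<open>W\<close>, \<open>laplace_step\<close> leaves an
  exponent affine in the earlier X's, because the intensity is. Exponentials with nonnegative
  weights are thus reproduced, and the step can be iterated.\<close>

lemma laplace_weighted_step:
  assumes w: "\<And>s. w s \<ge> 0"
  shows "expectation (\<lambda>\<omega>. exp (- (\<Sum>s=1..Suc n. w s * hawkes_X ell Z s \<omega>)))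
    = exp (- (\<nu> * laplace_deficit (w (Suc n)))) *
      expectation (\<lambda>\<omega>. exp (- (\<Sum>s=1..n. (w s + laplace_deficit (w (Suc n)) * \<alpha> (Suc n - s)) * hawkes_X ell Z s \<omega>)))"
proof -
  let ?p = "laplace_deficit (w (Suc n))"
  let ?X = "hawkes_X ell Z"
  define W where "W = (\<lambda>\<omega>. exp (- (\<Sum>s=1..n. w s * ?X s \<omega>)))"
  have WF: "W \<in> borel_measurable (hawkes_filtration M ell Z (Suc n - 1))"
  proof -
    have [measurable]: "(\<lambda>\<omega>. \<Sum>s=1..n. w s * ?X s \<omega>) \<in> borel_measurable (hawkes_filtration M ell Z n)"
      by (intro borel_measurable_sum borel_measurable_times borel_measurable_const
          hawkes_X_filtration_measurable)
    show ?thesis unfolding W_def diff_Suc_1 by measurable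
  qed
  have W01: "AE \<omega> in M. W \<omega> \<in> {0..1}"
    using hawkes_X_nonneg by eventually_elim (auto simp: W_def intro!: sum_nonneg mult_nonneg_nonneg w)
  have I: "hawkes_intensity \<nu> \<alpha> ell Z (Suc n) \<omega> = \<nu> + (\<Sum>s=1..n. \<alpha> (Suc n - s) * ?X s \<omega>)" for \<omega>
  proof -
    have "(\<Sum>s=1..n. \<alpha> s * ?X (Suc n - s) \<omega>) = (\<Sum>s=1..n. \<alpha> (Suc n - s) * ?X s \<omega>)"
      by (rule sum.reindex_bij_witness[where i="\<lambda>s. Suc n - s" and j="\<lambda>s. Suc n - s"]) auto
    then show ?thesis by (simp add: hawkes_intensity_def)
  qed
  have "expectation (\<lambda>\<omega>. exp (- (\<Sum>s=1..Suc n. w s * ?X s \<omega>)))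
      = expectation (\<lambda>\<omega>. W \<omega> * exp (- (w (Suc n) * ?X (Suc n) \<omega>)))"
    by (simp add: W_def exp_add[symmetric] algebra_simps)
  also have "\<dots> = expectation (\<lambda>\<omega>. W \<omega> * exp (- (hawkes_intensity \<nu> \<alpha> ell Z (Suc n) \<omega> * ?p)))"
    by (rule laplace_step[OF _ w WF W01]) simp
  also have "\<dots> = expectation (\<lambda>\<omega>. exp (- (\<nu> * ?p)) * exp (- (\<Sum>s=1..n. (w s + ?p * \<alpha> (Suc n - s)) * ?X s \<omega>)))"
    unfolding I W_def
    by (simp add: exp_add[symmetric] algebra_simps sum.distrib sum_distrib_left)
  finally show ?thesis by simp
qed

lemma laplace_hawkes_L:
  assumes x: "x \<ge> 0" and nonneg: "\<And>k. hawkes_weight laplace_deficit \<alpha> x k \<ge> 0"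
  shows "expectation (\<lambda>\<omega>. exp (- (x * hawkes_L ell Z t \<omega>)))
    = exp (- (\<nu> * (\<Sum>k<t. laplace_deficit (hawkes_weight laplace_deficit \<alpha> x k))))"
proof -
  let ?h = "hawkes_weight laplace_deficit \<alpha> x"
  let ?X = "hawkes_X ell Z"
  \<comment> \<open>\<open>w j s\<close> is the weight of \<open>X\<^sub>s\<close> once the last \<open>j\<close> time steps have been integrated out.\<close>
  define w where "w j s = x + (\<Sum>k<j. laplace_deficit (?h k) * \<alpha> (t - k - s))" for j s
  have w0: "w j s \<ge> 0" for j s
    unfolding w_def using x by (intro add_nonneg_nonneg sum_nonneg mult_nonneg_nonneg alpha_nonneg
        laplace_deficit_bounds nonneg)
  have "expectation (\<lambda>\<omega>. exp (- (x * hawkes_L ell Z t \<omega>)))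
      = exp (- (\<nu> * (\<Sum>k<j. laplace_deficit (?h k)))) *
        expectation (\<lambda>\<omega>. exp (- (\<Sum>s=1..t - j. w j s * ?X s \<omega>)))" if "j \<le> t" for j
    using that
  proof (induction j)
    case 0
    show ?case by (simp add: w_def hawkes_L_def sum_distrib_left)
  next
    case (Suc j)
    define n where "n = t - Suc j"
    have n: "t - j = Suc n" using Suc.prems by (simp add: n_def)
    \<comment> \<open>At the latest remaining time \<open>s = t - j\<close> the lag
      \<open>t - k - s\<close> is \<open>j - k\<close>, so the weight there satisfies the defining
      recursion.\<close>
    have top: "w j (Suc n) = ?h j"
      using Suc.prems by (subst hawkes_weight.simps) (auto simp: w_def n[symmetric] intro!: sum.cong arg_cong[where f=\<alpha>])
    have next': "w j s + laplace_deficit (?h j) * \<alpha> (Suc n - s) = w (Suc j) s" for s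
      by (simp add: w_def n[symmetric])
    show ?case
      using Suc.IH Suc.prems
      unfolding n laplace_weighted_step[OF w0] top next' n_def[symmetric]
      by (simp add: mult_exp_exp distrib_left)
  qed
  \<comment> \<open>For \<open>j = t\<close> no X is left and the remaining expectation is
    1.\<close>
  from this[of t] show ?thesis by (simp add: prob_space)
qed

end

theorem theorem2p2:
  fixes M :: "'a measure"
    and \<nu> :: real
    and \<alpha> :: "nat \<Rightarrow> real"
    and ell :: "nat \<Rightarrow> nat \<Rightarrow> 'a \<Rightarrow> real"
    and Z :: "nat \<Rightarrow> 'a \<Rightarrow> nat"
  assumes "marked_hawkes M \<nu> \<alpha> ell Z"
    and "summable (\<lambda>t. \<alpha> (Suc t))"
    and "norm1 \<alpha> * integral\<^sup>L M (ell 1 1) < 1"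
  shows "tendsto_in_prob M (\<lambda>t \<omega>. hawkes_L ell Z t \<omega> / real t)
           (\<nu> * integral\<^sup>L M (ell 1 1) / (1 - norm1 \<alpha> * integral\<^sup>L M (ell 1 1)))"
proof -
  interpret marked_hawkes M \<nu> \<alpha> ell Z by fact
  let ?m = "expectation (ell 1 1)"
  let ?h = "hawkes_weight laplace_deficit \<alpha>"
  \<comment> \<open>These discharge the assumptions on the recursion with
    \<open>p = laplace_deficit\<close> and \<open>m = ?m\<close>.\<close>
  note hyps = laplace_deficit_bounds(1,3) alpha_nonneg assms(2) mark_expectation_nonneg assms(3)
  show ?thesis
  proof (rule tendsto_in_prob_laplace)
    show "(\<lambda>\<omega>. hawkes_L ell Z n \<omega> / real n) \<in> borel_measurable M" for n
      using hawkes_L_measurable by measurable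
    show "AE \<omega> in M. hawkes_L ell Z n \<omega> / real n \<ge> 0" for n
      using hawkes_X_nonneg by eventually_elim (auto simp: hawkes_L_def intro!: divide_nonneg_nonneg sum_nonneg)
    fix \<theta> :: real assume \<theta>: "\<theta> > 0"
    \<comment> \<open>The transform formula at \<open>x = \<theta> / n\<close>; the required
      nonnegativity of the weights comes from \<open>hawkes_weight_bounds\<close>.\<close>
    have "expectation (\<lambda>\<omega>. exp (- (\<theta> * (hawkes_L ell Z n \<omega> / real n))))
        = exp (- (\<nu> * (\<Sum>k<n. laplace_deficit (?h (\<theta> / real n) k))))" for n
      using laplace_hawkes_L[of "\<theta> / real n" n] hawkes_weight_bounds[OF hyps, of "\<theta> / real n"] \<theta>
      by simp
    moreover have "(\<lambda>n. exp (- (\<nu> * (\<Sum>k<n. laplace_deficit (?h (\<theta> / real n) k)))))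
        \<longlonglongrightarrow> exp (- (\<nu> * (?m * \<theta> / (1 - norm1 \<alpha> * ?m))))"
      by (intro tendsto_intros sum_exponent_tendsto[OF hyps] laplace_deficit_gap_mono
          laplace_deficit_deriv) (use \<theta> in auto)
    ultimately show "(\<lambda>n. expectation (\<lambda>\<omega>. exp (- (\<theta> * (hawkes_L ell Z n \<omega> / real n)))))
        \<longlonglongrightarrow> exp (- (\<theta> * (\<nu> * ?m / (1 - norm1 \<alpha> * ?m))))"
      by (simp add: mult.commute mult.left_commute)
  qed
qed

end
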